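(* Let $f:\mathbb{R}^d\to\mathbb{R}$ be any fixed target function and let $x_1,\dots,x_{n+1}\overset{i.i.d.}{\sim}\mathcal{N}(0,\Sigma)$ in $\mathbb{R}^d$. Let $y_i=f(x_i)$ for $i\le n$, $x_{\mathrm{query}}=x_{n+1}$, $y_{\mathrm{query}}=f(x_{n+1})$, and form the prompt $$Z=\begin{bmatrix}1&\cdots&1&1\\ x_1&\cdots&x_n&x_{n+1}\\ \mathbf{0}&\cdots&\mathbf{0}&\mathbf{0}\\ y_1&\cdots&y_n&0\end{bmatrix}\in\mathbb{R}^{(\bar d+1)\times(n+1)}.$$ Then for any linear Transformer $\mathsf{TF}_{\mathrm{lin}}$ (with any number of layers and any weights), its prediction $\hat y_{\mathsf{TF}_{\mathrm{lin}}}$ on $Z$ satisfies $$\mathbb{E}_x\big[(\hat y_{\mathsf{TF}_{\mathrm{lin}}}+y_{\mathrm{query}})^2\big]\ \ge\ \min_{\alpha\in\mathbb{R},\,\beta\in\mathbb{R}^d}\mathbb{E}_x\big[(\langle x_{\mathrm{query}},\beta\rangle+\alpha+y_{\mathrm{query}})^2\big].$$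
   Context: The embedding dimension satisfies $\bar d\ge d+1$, and the prompt contains $\bar d-d-1$ rows of zeros (denoted $\mathbf 0$). A linear self-attention (LSA) layer with weights $\mathbf{P},\mathbf{Q}\in\mathbb{R}^{(\bar d+1)\times(\bar d+1)}$ is the map $\mathsf{attn}(Z)=Z+\frac1n\mathbf{P}ZM(Z^\top\mathbf{Q}Z)$ on $\mathbb{R}^{(\bar d+1)\times(n+1)}$, where $M=\mathrm{diag}(\mathbf{I}_n,0)$. A linear Transformer with $L$ layers is a composition of $L$ LSA layers (each with its own weights): $Z^{(0)}=Z$, $Z^{(\ell+1)}=\mathsf{attn}(Z^{(\ell)})$, $\ell=0,\dots,L-1$. Its prediction is the entry $\hat y=Z^{(L)}[\bar d+1,n+1]$. (By the sign convention of the loss, the prediction is meant to approximate $-y_{\mathrm{query}}$.) *)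

theory Defs
  imports "HOL-Probability.Probability" "Jordan_Normal_Form.Matrix"
begin

text \<open>
  Data points live in \<^typ>\<open>real^'d\<close>, so that \<open>d = CARD('d)\<close>; prompts and weights, whose
  dimensions vary, are matrices of type \<^typ>\<open>real mat\<close>, indexed from \<open>0\<close>.
\<close>

text \<open>\<open>N(0, s\<^sup>2)\<close> on the real line; \<^const>\<open>normal_density\<close> does not cover \<open>s = 0\<close>.\<close>

definition centered_normal :: "real \<Rightarrow> real measure" where
  "centered_normal s =
     (if s = 0 then return borel 0 else density lborel (\<lambda>x. ennreal (normal_density 0 s x)))"

text \<open>
  The measure \<open>\<mu>\<close> is \<open>N(0, \<Sigma>)\<close>: every linear functional \<open>\<langle>t, x\<rangle>\<close> is distributed as
  \<open>N(0, t\<^sup>T \<Sigma> t)\<close>. The covariance matrix may be singular. Symmetry is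
  required explicitly because the quadratic form only sees the symmetric part of \<open>\<Sigma>\<close>.
\<close>

definition centered_gaussian :: "real^'d^'d \<Rightarrow> (real^'d) measure \<Rightarrow> bool" where
  "centered_gaussian \<Sigma> \<mu> \<longleftrightarrow>
     Finite_Cartesian_Product.transpose \<Sigma> = \<Sigma> \<and>
     (\<forall>t. 0 \<le> inner t (\<Sigma> *v t)) \<and>
     sets \<mu> = sets borel \<and>
     (\<forall>t. distr \<mu> borel (\<lambda>x. inner t x) = centered_normal (sqrt (inner t (\<Sigma> *v t))))"

text \<open>
  The prompt of size \<open>(db + 1) \<times> (n + 1)\<close> for the points \<open>x 0, \<dots>, x n\<close>, the last one being the
  query. The enumeration \<open>c\<close> of the coordinates, from \<open>{1..CARD('d)}\<close> onto \<^typ>\<open>'d\<close>, says which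
  coordinate is placed in which row.
\<close>

definition prompt ::
  "(nat \<Rightarrow> 'd::finite) \<Rightarrow> nat \<Rightarrow> nat \<Rightarrow> (real^'d \<Rightarrow> real) \<Rightarrow> (nat \<Rightarrow> real^'d) \<Rightarrow> real mat" where
  "prompt c db n f x = Matrix.mat (db + 1) (n + 1) (\<lambda>(r, j).
     if r = 0 then 1
     else if r \<le> CARD('d) then vec_nth (x j) (c r)
     else if r = db \<and> j < n then f (x j)
     else 0)"

definition mask :: "nat \<Rightarrow> real mat" where
  "mask n = four_block_mat (1\<^sub>m n) (0\<^sub>m n 1) (0\<^sub>m 1 n) (0\<^sub>m 1 1)"

definition lsa :: "nat \<Rightarrow> real mat \<Rightarrow> real mat \<Rightarrow> real mat \<Rightarrow> real mat" where
  "lsa n P Q Z = Z + (1 / real n) \<cdot>\<^sub>m (P * Z * mask n * (transpose_mat Z * Q * Z))"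

text \<open>The list contains the weights \<open>(P, Q)\<close> of the layers; its head is applied first.\<close>

definition linear_transformer :: "nat \<Rightarrow> (real mat \<times> real mat) list \<Rightarrow> real mat \<Rightarrow> real mat" where
  "linear_transformer n W Z = fold (\<lambda>(P, Q). lsa n P Q) W Z"

definition prediction :: "nat \<Rightarrow> nat \<Rightarrow> (real mat \<times> real mat) list \<Rightarrow> real mat \<Rightarrow> real" where
  "prediction db n W Z = linear_transformer n W Z $$ (db, n)"

text \<open>
  Expected squares are taken in the extended nonnegative reals, so they are meaningful
  without any integrability assumption.
\<close>

definition affine_risk ::
  "'w measure \<Rightarrow> ('w \<Rightarrow> real^'d) \<Rightarrow> ('w \<Rightarrow> real) \<Rightarrow> real \<Rightarrow> real^'d \<Rightarrow> ennreal" where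
  "affine_risk M x y \<alpha> \<beta> = (\<integral>\<^sup>+ \<omega>. ennreal ((inner (x \<omega>) \<beta> + \<alpha> + y \<omega>)\<^sup>2) \<partial>M)"

end

theory Submission imports Defs begin

text \<open>
  The mask removes the query from the attention weights, so each layer multiplies the state from the
  left by a matrix that depends only on the first \<open>n\<close> columns. Since the label entry of the query
  column is \<open>0\<close>, the prediction is \<open>\<langle>b, x\<^sub>q\<rangle> + a\<close>, where \<open>a\<close> and \<open>b\<close> are functions of the context
  and hence independent of the query \<open>x\<^sub>q\<close>. Conditionally on the context, the risk is that of a fixed
  affine predictor, so it is at least the best affine risk.
\<close>

section \<open>The query column evolves linearly\<close>

lemma mask_carrier [simp]: "mask n \<in> carrier_mat (Suc n) (Suc n)"
  by (rule carrier_matI) (simp_all add: mask_def)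

lemma dim_mask [simp]: "dim_row (mask n) = Suc n" "dim_col (mask n) = Suc n"
  by (simp_all add: mask_def)

lemma mask_index:
  "i < Suc n \<Longrightarrow> j < Suc n \<Longrightarrow> mask n $$ (i, j) = (if i = j \<and> i < n then 1 else 0)"
  by (auto simp: mask_def)

lemma transpose_mask: "transpose_mat (mask n) = mask n"
  by (rule eq_matI) (auto simp: mask_index)

lemma index_mult_mat_sum:
  assumes "A \<in> carrier_mat m k" "B \<in> carrier_mat k l" "i < m" "j < l"
  shows "(A * B) $$ (i, j) = (\<Sum>r\<in>{0..<k}. A $$ (i, r) * B $$ (r, j))"
  using assms by (auto simp: scalar_prod_def)

lemma mult_mask_index:
  assumes "Z \<in> carrier_mat m (Suc n)" "i < m" "j < Suc n"
  shows "(Z * mask n) $$ (i, j) = (if j < n then Z $$ (i, j) else 0)"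
proof -
  have "(Z * mask n) $$ (i, j) = (\<Sum>l\<in>{0..<Suc n}. Z $$ (i, l) * mask n $$ (l, j))"
    using assms by (intro index_mult_mat_sum) auto
  also have "\<dots> = (\<Sum>l\<in>{0..<Suc n}. if l = j then (if j < n then Z $$ (i, j) else 0) else 0)"
    using assms by (intro sum.cong) (auto simp: mask_index)
  finally show ?thesis using assms by simp
qed

text \<open>Right multiplication by the mask erases the query column, so \<open>Z * mask n\<close>
  records exactly the first \<open>n\<close> columns. Equality of such products is how agreement on
  the context is passed through the layers.\<close>

lemma mult_mask_cong:
  assumes "Z \<in> carrier_mat m (Suc n)" "Z' \<in> carrier_mat m (Suc n)"
    and "\<And>i j. i < m \<Longrightarrow> j < n \<Longrightarrow> Z $$ (i, j) = Z' $$ (i, j)"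
  shows "Z * mask n = Z' * mask n"
  using assms
  by (intro eq_matI) (auto simp del: index_mult_mat(1) simp: mult_mask_index)

lemma mask_idem: "mask n * mask n = mask n"
  by (rule eq_matI)
    (auto simp del: index_mult_mat(1) simp: mult_mask_index[where m = "Suc n"] mask_index)

text \<open>Both factors \<open>Z\<close> inside the product carry the mask, so that dependence on
  the context alone can be read off directly. The update in \<open>lsa\<close> shows the mask only
  once; idempotence reconciles the two forms.\<close>

definition lsa_multiplier :: "nat \<Rightarrow> real mat \<Rightarrow> real mat \<Rightarrow> real mat \<Rightarrow> real mat" where
  "lsa_multiplier n P Q Z = 1\<^sub>m (dim_row Z) +
     (1 / real n) \<cdot>\<^sub>m (P * (Z * mask n) * (transpose_mat (Z * mask n) * Q))"

lemma lsa_multiplier_carrier [simp]: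
  assumes "Z \<in> carrier_mat m (Suc n)" "P \<in> carrier_mat m m" "Q \<in> carrier_mat m m"
  shows "lsa_multiplier n P Q Z \<in> carrier_mat m m"
  using assms by (auto simp: lsa_multiplier_def)

lemma lsa_carrier [simp]:
  assumes "Z \<in> carrier_mat m (Suc n)" "P \<in> carrier_mat m m" "Q \<in> carrier_mat m m"
  shows "lsa n P Q Z \<in> carrier_mat m (Suc n)"
  using assms by (auto simp: lsa_def)

text \<open>Associativity moves the last factor \<open>Z\<close> of the attention term outside,
  leaving a square matrix acting from the left.\<close>

lemma lsa_eq_mult:
  assumes Z: "Z \<in> carrier_mat m (Suc n)" and P: "P \<in> carrier_mat m m" and Q: "Q \<in> carrier_mat m m"
  shows "lsa n P Q Z = lsa_multiplier n P Q Z * Z"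
proof -
  let ?Y = "Z * mask n"
  let ?T = "transpose_mat Z"
  have Y: "?Y \<in> carrier_mat m (Suc n)" using Z by auto
  have T: "?T \<in> carrier_mat (Suc n) m" using Z by auto
  have tY: "transpose_mat ?Y = mask n * ?T"
    using transpose_mult[OF Z mask_carrier] by (simp add: transpose_mask)
  have YM: "?Y * mask n = ?Y"
    using assoc_mult_mat[OF Z mask_carrier mask_carrier] by (simp add: mask_idem)
  have TQ: "?T * Q \<in> carrier_mat (Suc n) m" using T Q by auto
  \<comment> \<open>The mask is symmetric, so transposing \<open>?Y\<close> puts it next to the mask
    already in \<open>?Y\<close>, which absorbs it by idempotence.\<close>
  have "?Y * (transpose_mat ?Y * Q) = ?Y * (mask n * (?T * Q))"
    unfolding tY using assoc_mult_mat[OF mask_carrier T Q] by simp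
  also have "\<dots> = ?Y * (?T * Q)"
    using assoc_mult_mat[OF Y mask_carrier TQ] YM by simp
  finally have e: "?Y * (transpose_mat ?Y * Q) = ?Y * (?T * Q)" .
  have tYQ: "transpose_mat ?Y * Q \<in> carrier_mat (Suc n) m" using Y Q by auto
  have PY: "P * ?Y \<in> carrier_mat m (Suc n)" using P Y by auto
  have R: "P * ?Y * (transpose_mat ?Y * Q) = P * ?Y * (?T * Q)"
    using assoc_mult_mat[OF P Y tYQ] assoc_mult_mat[OF P Y TQ] e by simp
  have PYR: "P * ?Y * (?T * Q) \<in> carrier_mat m m" using PY TQ by auto
  have "lsa_multiplier n P Q Z * Z = 1\<^sub>m m * Z + ((1 / real n) \<cdot>\<^sub>m (P * ?Y * (?T * Q))) * Z"
    using add_mult_distrib_mat[OF one_carrier_mat smult_carrier_mat[OF PYR] Z] Z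
    by (simp add: lsa_multiplier_def R carrier_matD)
  also have "\<dots> = Z + (1 / real n) \<cdot>\<^sub>m (P * ?Y * (?T * Q) * Z)"
    using mult_smult_assoc_mat[OF PYR Z] Z by simp
  also have "P * ?Y * (?T * Q) * Z = P * ?Y * (?T * Q * Z)"
    by (rule assoc_mult_mat[OF PY TQ Z])
  also have "P * ?Y = P * Z * mask n"
    using assoc_mult_mat[OF P Z mask_carrier] by simp
  finally show ?thesis by (simp add: lsa_def)
qed

text \<open>Later layers act further to the left. The multiplier of a layer depends on the state it
  receives, so the tail is evaluated at the output of the first layer.\<close>

primrec transformer_multiplier ::
  "nat \<Rightarrow> (real mat \<times> real mat) list \<Rightarrow> real mat \<Rightarrow> real mat" where
  "transformer_multiplier n [] Z = 1\<^sub>m (dim_row Z)"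
| "transformer_multiplier n (w # W) Z =
     transformer_multiplier n W (lsa n (fst w) (snd w) Z) * lsa_multiplier n (fst w) (snd w) Z"

definition square_weights :: "nat \<Rightarrow> (real mat \<times> real mat) list \<Rightarrow> bool" where
  "square_weights m W \<longleftrightarrow> (\<forall>(P, Q) \<in> set W. P \<in> carrier_mat m m \<and> Q \<in> carrier_mat m m)"

lemma square_weights_Cons [simp]:
  "square_weights m (w # W) \<longleftrightarrow>
     fst w \<in> carrier_mat m m \<and> snd w \<in> carrier_mat m m \<and> square_weights m W"
  by (auto simp: square_weights_def)

lemma transformer_multiplier_carrier:
  "Z \<in> carrier_mat m (Suc n) \<Longrightarrow> square_weights m W \<Longrightarrow>
     transformer_multiplier n W Z \<in> carrier_mat m m"
proof (induction W arbitrary: Z)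
  case (Cons w W)
  then have "transformer_multiplier n W (lsa n (fst w) (snd w) Z) \<in> carrier_mat m m" by simp
  then show ?case using Cons.prems lsa_multiplier_carrier[of Z m n "fst w" "snd w"] by auto
qed auto

lemma linear_transformer_eq_mult:
  "Z \<in> carrier_mat m (Suc n) \<Longrightarrow> square_weights m W \<Longrightarrow>
     linear_transformer n W Z = transformer_multiplier n W Z * Z"
proof (induction W arbitrary: Z)
  case Nil
  then show ?case by (auto simp: linear_transformer_def)
next
  case (Cons w W)
  let ?Z = "lsa n (fst w) (snd w) Z"
  have Z: "?Z \<in> carrier_mat m (Suc n)" using Cons.prems by simp
  have "linear_transformer n (w # W) Z = linear_transformer n W ?Z"
    by (simp add: linear_transformer_def case_prod_beta)
  also have "\<dots> = transformer_multiplier n W ?Z * ?Z"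
    using Cons.IH[OF Z] Cons.prems by simp
  also have "\<dots> = transformer_multiplier n W ?Z * (lsa_multiplier n (fst w) (snd w) Z * Z)"
    using Cons.prems lsa_eq_mult[of Z m n "fst w" "snd w"] by simp
  also have "\<dots> = transformer_multiplier n W ?Z * lsa_multiplier n (fst w) (snd w) Z * Z"
    using Cons.prems
    by (intro assoc_mult_mat[symmetric, of _ m m _ m _ "Suc n"]
        transformer_multiplier_carrier Z) auto
  finally show ?case by simp
qed

text \<open>The context evolves without the query: a layer multiplies the masked state by a matrix
  computed from the masked state. Agreement on the context therefore survives each layer, and all
  multipliers coincide.\<close>

lemma transformer_multiplier_cong:
  assumes "Z * mask n = Z' * mask n"
    and "Z \<in> carrier_mat m (Suc n)" "Z' \<in> carrier_mat m (Suc n)" "square_weights m W"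
  shows "transformer_multiplier n W Z = transformer_multiplier n W Z'"
  using assms
proof (induction W arbitrary: Z Z')
  case Nil
  then show ?case by auto
next
  case (Cons w W)
  have eq: "lsa_multiplier n (fst w) (snd w) Z = lsa_multiplier n (fst w) (snd w) Z'"
    using Cons.prems by (simp add: lsa_multiplier_def carrier_matD)
  have lsa_mask: "lsa n (fst w) (snd w) Y * mask n = lsa_multiplier n (fst w) (snd w) Y * (Y * mask n)"
    if "Y \<in> carrier_mat m (Suc n)" for Y
    using that Cons.prems lsa_eq_mult[of Y m n "fst w" "snd w"]
    by (simp add: assoc_mult_mat[of _ m m _ "Suc n" _ "Suc n"])
  have "lsa n (fst w) (snd w) Z * mask n = lsa n (fst w) (snd w) Z' * mask n"
    using Cons.prems by (simp add: lsa_mask eq)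
  from Cons.IH[OF this] Cons.prems eq show ?case by simp
qed

lemma prompt_carrier [simp]: "prompt c db n f x \<in> carrier_mat (Suc db) (Suc n)"
  by (simp add: prompt_def)

text \<open>The query column of the prompt is \<open>1\<close>, then the coordinates of
  \<open>x n\<close>, then zeros. Pairing it with row \<open>db\<close> of the multiplier gives the
  intercept from column \<open>0\<close> and the slope from columns \<open>1\<close> to
  \<open>CARD('d)\<close>.\<close>

lemma prediction_affine:
  fixes c :: "nat \<Rightarrow> 'd::finite" and x :: "nat \<Rightarrow> real^'d" and f :: "real^'d \<Rightarrow> real" and n :: nat
  assumes W: "square_weights (Suc db) W" and db: "db \<ge> CARD('d) + 1"
  defines "T \<equiv> transformer_multiplier n W (prompt c db n f x)"
  shows "prediction db n W (prompt c db n f x) =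
    inner (x n) (\<Sum>k=1..CARD('d). T $$ (db, k) *\<^sub>R axis (c k) 1) + T $$ (db, 0)"
proof -
  let ?Z = "prompt c db n f x"
  have T: "T \<in> carrier_mat (Suc db) (Suc db)"
    unfolding T_def by (rule transformer_multiplier_carrier[OF prompt_carrier W])
  have "prediction db n W ?Z = (T * ?Z) $$ (db, n)"
    by (simp add: prediction_def linear_transformer_eq_mult[OF prompt_carrier W] T_def)
  also have "\<dots> = (\<Sum>k\<in>{0..<Suc db}. T $$ (db, k) * ?Z $$ (k, n))"
    using T prompt_carrier[of c db n f x] by (intro index_mult_mat_sum) auto
  \<comment> \<open>A label is entered only for \<open>j < n\<close>, so in column \<open>n\<close>
    every row beyond \<open>CARD('d)\<close> vanishes, the label row included.\<close>
  also have "\<dots> = (\<Sum>k\<in>{0..<Suc db}. if k = 0 then T $$ (db, 0)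
      else if k \<le> CARD('d) then T $$ (db, k) * vec_nth (x n) (c k) else 0)"
    by (intro sum.cong) (auto simp: prompt_def)
  also have "\<dots> = (\<Sum>k\<in>{0..CARD('d)}. if k = 0 then T $$ (db, 0)
      else T $$ (db, k) * vec_nth (x n) (c k))"
    using db by (intro sum.mono_neutral_cong_right) auto
  also have "\<dots> = T $$ (db, 0) + (\<Sum>k=1..CARD('d). T $$ (db, k) * vec_nth (x n) (c k))"
    by (simp add: sum.atLeast_Suc_atMost)
  also have "(\<Sum>k=1..CARD('d). T $$ (db, k) * vec_nth (x n) (c k)) =
      inner (x n) (\<Sum>k=1..CARD('d). T $$ (db, k) *\<^sub>R axis (c k) 1)"
    by (simp add: inner_sum_right inner_axis)
  finally show ?thesis by simp
qed

section \<open>Measurability of matrix entries\<close>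

text \<open>Measurability is stated entrywise, which avoids a sigma-algebra on a type whose elements
  have different dimensions. The dimensions are fixed at every point \<open>w\<close>, so that index
  rules apply unconditionally.\<close>

definition measurable_mat :: "'a measure \<Rightarrow> nat \<Rightarrow> nat \<Rightarrow> ('a \<Rightarrow> real mat) \<Rightarrow> bool" where
  "measurable_mat N m k Z \<longleftrightarrow> (\<forall>w. Z w \<in> carrier_mat m k) \<and>
     (\<forall>i<m. \<forall>j<k. (\<lambda>w. Z w $$ (i, j)) \<in> borel_measurable N)"

lemma measurable_mat_const: "A \<in> carrier_mat m k \<Longrightarrow> measurable_mat N m k (\<lambda>w. A)"
  by (simp add: measurable_mat_def)

lemma measurable_mat_add:
  assumes "measurable_mat N m k A" "measurable_mat N m k B"
  shows "measurable_mat N m k (\<lambda>w. A w + B w)"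
proof -
  have "(\<lambda>w. A w $$ (i, j) + B w $$ (i, j)) \<in> borel_measurable N" if "i < m" "j < k" for i j
    using that assms by (intro borel_measurable_add) (auto simp: measurable_mat_def)
  moreover
  have "(A w + B w) $$ (i, j) = A w $$ (i, j) + B w $$ (i, j)" if "i < m" "j < k" for w i j
    using that assms by (metis measurable_mat_def index_add_mat(1) carrier_matD)
  ultimately show ?thesis using assms by (auto simp: measurable_mat_def)
qed

lemma measurable_mat_smult:
  assumes "measurable_mat N m k A"
  shows "measurable_mat N m k (\<lambda>w. a \<cdot>\<^sub>m A w)"
proof -
  have "(\<lambda>w. a * A w $$ (i, j)) \<in> borel_measurable N" if "i < m" "j < k" for i j
    using that assms by (intro borel_measurable_times) (auto simp: measurable_mat_def)
  moreover
  have "(a \<cdot>\<^sub>m A w) $$ (i, j) = a * A w $$ (i, j)" if "i < m" "j < k" for w i j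
    using that assms by (metis measurable_mat_def index_smult_mat(1) carrier_matD)
  ultimately show ?thesis using assms by (auto simp: measurable_mat_def)
qed

lemma measurable_mat_transpose:
  assumes "measurable_mat N m k A"
  shows "measurable_mat N k m (\<lambda>w. transpose_mat (A w))"
proof -
  have "transpose_mat (A w) $$ (i, j) = A w $$ (j, i)" if "i < k" "j < m" for w i j
    using that assms by (metis measurable_mat_def index_transpose_mat(1) carrier_matD)
  then show ?thesis using assms by (auto simp: measurable_mat_def)
qed

lemma measurable_mat_mult:
  assumes "measurable_mat N m k A" "measurable_mat N k l B"
  shows "measurable_mat N m l (\<lambda>w. A w * B w)"
proof -
  have c: "A w \<in> carrier_mat m k" "B w \<in> carrier_mat k l" for w
    using assms by (auto simp: measurable_mat_def)
  have "(A w * B w) $$ (i, j) = (\<Sum>r\<in>{0..<k}. A w $$ (i, r) * B w $$ (r, j))"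
    if "i < m" "j < l" for w i j
    using that c by (intro index_mult_mat_sum)
  moreover have "A w * B w \<in> carrier_mat m l" for w
    using c[of w] by auto
  ultimately show ?thesis
    using assms by (auto simp: measurable_mat_def intro!: borel_measurable_sum borel_measurable_times)
qed

lemma measurable_mat_lsa_multiplier:
  assumes Z: "measurable_mat N m (Suc n) Z" and "P \<in> carrier_mat m m" "Q \<in> carrier_mat m m"
  shows "measurable_mat N m m (\<lambda>w. lsa_multiplier n P Q (Z w))"
proof -
  have "dim_row (Z w) = m" for w using Z by (auto simp: measurable_mat_def)
  moreover have Y: "measurable_mat N m (Suc n) (\<lambda>w. Z w * mask n)"
    by (rule measurable_mat_mult[OF Z measurable_mat_const[OF mask_carrier]])
  have "measurable_mat N m m (\<lambda>w. P * (Z w * mask n) * (transpose_mat (Z w * mask n) * Q))"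
    using assms(2,3)
    by (intro measurable_mat_mult[OF measurable_mat_mult[OF measurable_mat_const Y]
          measurable_mat_mult[OF measurable_mat_transpose[OF Y] measurable_mat_const]])
  ultimately show ?thesis
    unfolding lsa_multiplier_def
    by (auto intro!: measurable_mat_add measurable_mat_smult measurable_mat_const)
qed

lemma measurable_mat_lsa:
  assumes Z: "measurable_mat N m (Suc n) Z" and "P \<in> carrier_mat m m" "Q \<in> carrier_mat m m"
  shows "measurable_mat N m (Suc n) (\<lambda>w. lsa n P Q (Z w))"
proof -
  have "Z w \<in> carrier_mat m (Suc n)" for w using Z by (auto simp: measurable_mat_def)
  then have "(\<lambda>w. lsa n P Q (Z w)) = (\<lambda>w. lsa_multiplier n P Q (Z w) * Z w)"
    using assms lsa_eq_mult by blast
  then show ?thesis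
    using measurable_mat_mult[OF measurable_mat_lsa_multiplier[OF assms] Z] by simp
qed

text \<open>The entries are polynomials in the entries of \<open>Z\<close>. This makes the
  coefficients of the affine predictor measurable functions of the context.\<close>

lemma measurable_mat_transformer_multiplier:
  "measurable_mat N m (Suc n) Z \<Longrightarrow> square_weights m W \<Longrightarrow>
     measurable_mat N m m (\<lambda>w. transformer_multiplier n W (Z w))"
proof (induction W arbitrary: Z)
  case Nil
  then have "dim_row (Z w) = m" for w by (auto simp: measurable_mat_def)
  then show ?case by (simp add: measurable_mat_const)
next
  case (Cons w W)
  have "measurable_mat N m (Suc n) (\<lambda>v. lsa n (fst w) (snd w) (Z v))"
    using Cons.prems by (intro measurable_mat_lsa) auto
  from measurable_mat_mult[OF Cons.IH[OF this] measurable_mat_lsa_multiplier] Cons.prems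
  show ?case by simp
qed

lemma measurable_mat_prompt:
  assumes f: "f \<in> borel_measurable borel"
    and x: "\<And>j. j \<le> n \<Longrightarrow> (\<lambda>w. x w j) \<in> borel_measurable N"
  shows "measurable_mat N (Suc db) (Suc n) (\<lambda>w. prompt c db n f (x w))"
proof -
  have "(\<lambda>w. prompt c db n f (x w) $$ (r, j)) \<in> borel_measurable N"
    if "r < Suc db" "j < Suc n" for r j
  proof -
    have xj: "(\<lambda>w. x w j) \<in> borel_measurable N" using x that by simp
    have "(\<lambda>w. f (x w j)) \<in> borel_measurable N" by (rule measurable_compose[OF xj f])
    moreover have "(\<lambda>w. vec_nth (x w j) (c r)) \<in> borel_measurable N"
      using borel_measurable_inner[OF xj borel_measurable_const[of "axis (c r) 1"]]
      by (simp add: inner_axis)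
    ultimately show ?thesis using that by (simp add: prompt_def)
  qed
  then show ?thesis by (simp add: measurable_mat_def)
qed

section \<open>Attainment of the least squares risk\<close>

text \<open>The component of \<open>b\<close> orthogonal to the range of \<open>A\<close> lies in the kernel of \<open>A\<close>, and the form is
  affine along it, so boundedness forces \<open>b \<in> range A\<close>: the normal equations are solvable.\<close>

lemma quadratic_form_attains_min:
  fixes A :: "'a::euclidean_space \<Rightarrow> 'a"
  assumes lin: "linear A" and sym: "\<And>u v. inner (A u) v = inner u (A v)"
    and psd: "\<And>v. 0 \<le> inner v (A v)"
    and bdd: "\<And>v. 0 \<le> inner v (A v) + 2 * inner b v + d"
  shows "\<exists>v0. \<forall>v. inner v0 (A v0) + 2 * inner b v0 + d \<le> inner v (A v) + 2 * inner b v + d"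
proof -
  have sp: "span (range A) = range A"
    using linear_subspace_image[OF lin subspace_UNIV] by (simp add: span_eq_iff)
  obtain y z where y: "y \<in> span (range A)" and z: "\<And>w. w \<in> span (range A) \<Longrightarrow> inner z w = 0"
    and b: "b = y + z"
    using orthogonal_subspace_decomp_exists[of "range A" b]
    by (auto simp: real_inner_class.orthogonal_def)
  obtain u where u: "y = A u" using y sp by auto
  have zA: "inner z (A v) = 0" for v
    using z[of "A v"] by (simp add: sp)
  have bz: "inner b z = inner z z"
    using zA[of u] by (simp add: b u inner_add_left inner_commute[of "A u"])
  have "0 \<le> 2 * t * inner z z + d" for t
    using bdd[of "t *\<^sub>R z"] zA bz by (simp add: linear_scale[OF lin] algebra_simps)
  \<comment> \<open>If \<open>z\<close> were nonzero, the first choice of \<open>t\<close> would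
    give \<open>0 \<le> - d - 2\<close>, while \<open>t = 0\<close> gives
    \<open>0 \<le> d\<close>.\<close>
  from this[of "- (d + 1) / inner z z"] this[of "0"] have "z = 0"
    by (cases "z = 0") auto
  then have b': "b = A u" using b u by simp
  \<comment> \<open>Completing the square around the solution \<open>- u\<close> of the normal
    equations.\<close>
  have "inner v (A v) + 2 * inner b v - (inner (- u) (A (- u)) + 2 * inner b (- u)) =
      inner (v + u) (A (v + u))" for v
    using sym[of u v] sym[of v u]
    by (simp add: b' linear_add[OF lin] linear_neg[OF lin] inner_simps inner_commute)
  then have "inner (- u) (A (- u)) + 2 * inner b (- u) + d \<le> inner v (A v) + 2 * inner b v + d" for v
    using psd[of "v + u"] by (smt (verit))
  then show ?thesis by blast
qed

text \<open>Finite second moments turn the risk into a real quadratic in \<open>v\<close>, with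
  \<open>A\<close> the second moment operator of \<open>U\<close>, \<open>b\<close> the cross moment
  and \<open>d\<close> the second moment of \<open>Y\<close>. Being the integral of a square, it is
  bounded below by \<open>0\<close>, so the minimum is attained even for singular
  \<open>A\<close>.\<close>

lemma least_squares_attains_min_integrable:
  fixes U :: "'w \<Rightarrow> 'a::euclidean_space" and Y :: "'w \<Rightarrow> real"
  assumes [measurable]: "U \<in> borel_measurable M" "Y \<in> borel_measurable M"
    and U2: "integrable M (\<lambda>\<omega>. (norm (U \<omega>))\<^sup>2)" and Y2: "integrable M (\<lambda>\<omega>. (Y \<omega>)\<^sup>2)"
  shows "\<exists>v0. \<forall>v. (\<integral>\<^sup>+ \<omega>. ennreal ((inner (U \<omega>) v0 + Y \<omega>)\<^sup>2) \<partial>M)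
      \<le> (\<integral>\<^sup>+ \<omega>. ennreal ((inner (U \<omega>) v + Y \<omega>)\<^sup>2) \<partial>M)"
proof -
  define A where "A v = (\<integral>\<omega>. inner (U \<omega>) v *\<^sub>R U \<omega> \<partial>M)" for v
  define b where "b = (\<integral>\<omega>. Y \<omega> *\<^sub>R U \<omega> \<partial>M)"
  define d where "d = (\<integral>\<omega>. (Y \<omega>)\<^sup>2 \<partial>M)"
  have iA: "integrable M (\<lambda>\<omega>. inner (U \<omega>) v *\<^sub>R U \<omega>)" for v
  proof (rule Bochner_Integration.integrable_bound)
    show "integrable M (\<lambda>\<omega>. norm v * (norm (U \<omega>))\<^sup>2)" using U2 by simp
    show "AE \<omega> in M. norm (inner (U \<omega>) v *\<^sub>R U \<omega>) \<le> norm (norm v * (norm (U \<omega>))\<^sup>2)"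
    proof (rule AE_I2)
      fix \<omega>
      have "\<bar>inner (U \<omega>) v\<bar> * norm (U \<omega>) \<le> (norm (U \<omega>) * norm v) * norm (U \<omega>)"
        by (intro mult_right_mono Cauchy_Schwarz_ineq2) auto
      then show "norm (inner (U \<omega>) v *\<^sub>R U \<omega>) \<le> norm (norm v * (norm (U \<omega>))\<^sup>2)"
        by (simp add: power2_eq_square algebra_simps)
    qed
  qed measurable
  have ib: "integrable M (\<lambda>\<omega>. Y \<omega> *\<^sub>R U \<omega>)"
  proof (rule Bochner_Integration.integrable_bound)
    show "integrable M (\<lambda>\<omega>. (Y \<omega>)\<^sup>2 + (norm (U \<omega>))\<^sup>2)" using U2 Y2 by simp
    show "AE \<omega> in M. norm (Y \<omega> *\<^sub>R U \<omega>) \<le> norm ((Y \<omega>)\<^sup>2 + (norm (U \<omega>))\<^sup>2)"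
    proof (rule AE_I2)
      fix \<omega>
      have "2 * \<bar>Y \<omega>\<bar> * norm (U \<omega>) \<le> \<bar>Y \<omega>\<bar>\<^sup>2 + (norm (U \<omega>))\<^sup>2" by (rule sum_squares_bound)
      moreover have "0 \<le> \<bar>Y \<omega>\<bar> * norm (U \<omega>)" by simp
      ultimately have "\<bar>Y \<omega>\<bar> * norm (U \<omega>) \<le> (Y \<omega>)\<^sup>2 + (norm (U \<omega>))\<^sup>2"
        unfolding power2_abs by linarith
      then show "norm (Y \<omega> *\<^sub>R U \<omega>) \<le> norm ((Y \<omega>)\<^sup>2 + (norm (U \<omega>))\<^sup>2)" by simp
    qed
  qed measurable
  have "(inner (U \<omega>) v + Y \<omega>)\<^sup>2 =
      inner v (inner (U \<omega>) v *\<^sub>R U \<omega>) + 2 * inner (Y \<omega> *\<^sub>R U \<omega>) v + (Y \<omega>)\<^sup>2" for \<omega> v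
    by (simp add: power2_eq_square algebra_simps inner_commute)
  then have quad: "has_bochner_integral M (\<lambda>\<omega>. (inner (U \<omega>) v + Y \<omega>)\<^sup>2)
      (inner v (A v) + 2 * inner b v + d)" for v
    unfolding A_def b_def d_def
    by (simp only:) (intro has_bochner_integral_add has_bochner_integral_mult_right
      has_bochner_integral_inner_right has_bochner_integral_inner_left
      has_bochner_integral_integrable iA ib Y2)
  have nn: "(\<integral>\<^sup>+ \<omega>. ennreal ((inner (U \<omega>) v + Y \<omega>)\<^sup>2) \<partial>M) =
      ennreal (inner v (A v) + 2 * inner b v + d)" for v
    using quad[of v] nn_integral_eq_integral[of M "\<lambda>\<omega>. (inner (U \<omega>) v + Y \<omega>)\<^sup>2"]
    by (simp add: has_bochner_integral_iff)
  have inner_A: "inner u (A v) = (\<integral>\<omega>. inner (U \<omega>) u * inner (U \<omega>) v \<partial>M)" for u v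
    unfolding A_def using iA[of v] by (subst integral_inner_right[symmetric]) (auto simp: ac_simps inner_commute)
  have "\<exists>v0. \<forall>v. inner v0 (A v0) + 2 * inner b v0 + d \<le> inner v (A v) + 2 * inner b v + d"
  proof (rule quadratic_form_attains_min)
    show "linear A"
      by (rule linearI) (simp_all add: A_def inner_add_right scaleR_add_left iA flip: scaleR_scaleR)
    show "inner (A u) v = inner u (A v)" for u v
      by (subst inner_commute) (simp add: inner_A mult.commute)
    show "0 \<le> inner v (A v)" for v by (simp add: inner_A)
    show "0 \<le> inner v (A v) + 2 * inner b v + d" for v
      using quad[of v] integral_nonneg_AE[of "\<lambda>\<omega>. (inner (U \<omega>) v + Y \<omega>)\<^sup>2" M]
      by (simp add: has_bochner_integral_iff)
  qed
  then show ?thesis unfolding nn by (meson ennreal_leI)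
qed

text \<open>If every risk is infinite, any \<open>v0\<close> is a minimizer. Otherwise some
  \<open>v1\<close> has finite risk, and replacing \<open>Y\<close> by the square integrable
  residual at \<open>v1\<close> only translates the parameter \<open>v\<close>.\<close>

lemma least_squares_attains_min:
  fixes U :: "'w \<Rightarrow> 'a::euclidean_space" and Y :: "'w \<Rightarrow> real"
  assumes U[measurable]: "U \<in> borel_measurable M" and Y[measurable]: "Y \<in> borel_measurable M"
    and U2: "integrable M (\<lambda>\<omega>. (norm (U \<omega>))\<^sup>2)"
  shows "\<exists>v0. \<forall>v. (\<integral>\<^sup>+ \<omega>. ennreal ((inner (U \<omega>) v0 + Y \<omega>)\<^sup>2) \<partial>M)
      \<le> (\<integral>\<^sup>+ \<omega>. ennreal ((inner (U \<omega>) v + Y \<omega>)\<^sup>2) \<partial>M)"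
proof (cases "\<forall>v. (\<integral>\<^sup>+ \<omega>. ennreal ((inner (U \<omega>) v + Y \<omega>)\<^sup>2) \<partial>M) = \<infinity>")
  case False
  then obtain v1 where fin: "(\<integral>\<^sup>+ \<omega>. ennreal ((inner (U \<omega>) v1 + Y \<omega>)\<^sup>2) \<partial>M) < \<infinity>"
    by (auto simp: less_top)
  let ?Y = "\<lambda>\<omega>. inner (U \<omega>) v1 + Y \<omega>"
  have "integrable M (\<lambda>\<omega>. (?Y \<omega>)\<^sup>2)"
    by (rule integrableI_nonneg) (use fin in auto)
  from least_squares_attains_min_integrable[OF U _ U2 this] obtain v0 where
    v0: "\<And>v. (\<integral>\<^sup>+ \<omega>. ennreal ((inner (U \<omega>) v0 + ?Y \<omega>)\<^sup>2) \<partial>M)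
      \<le> (\<integral>\<^sup>+ \<omega>. ennreal ((inner (U \<omega>) v + ?Y \<omega>)\<^sup>2) \<partial>M)" by auto
  have shift: "inner (U \<omega>) v + ?Y \<omega> = inner (U \<omega>) (v + v1) + Y \<omega>" for \<omega> v
    by (simp add: inner_add_right)
  have "(\<integral>\<^sup>+ \<omega>. ennreal ((inner (U \<omega>) (v0 + v1) + Y \<omega>)\<^sup>2) \<partial>M)
      \<le> (\<integral>\<^sup>+ \<omega>. ennreal ((inner (U \<omega>) v + Y \<omega>)\<^sup>2) \<partial>M)" for v
    using v0[of "v - v1"] unfolding shift by simp
  then show ?thesis by blast
qed auto

text \<open>Affine regression is linear regression on the vector \<open>(1, x)\<close>, with
  parameter \<open>(\<alpha>, \<beta>)\<close>.\<close>

lemma affine_risk_attains_min: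
  fixes x :: "'w \<Rightarrow> real^'d"
  assumes "prob_space M" and [measurable]: "x \<in> borel_measurable M" "y \<in> borel_measurable M"
    and x2: "integrable M (\<lambda>\<omega>. (norm (x \<omega>))\<^sup>2)"
  shows "\<exists>\<alpha>0 \<beta>0. \<forall>\<alpha> \<beta>. affine_risk M x y \<alpha>0 \<beta>0 \<le> affine_risk M x y \<alpha> \<beta>"
proof -
  interpret prob_space M by fact
  let ?U = "\<lambda>\<omega>. (1 :: real, x \<omega>)"
  have risk: "affine_risk M x y (fst v) (snd v) =
      (\<integral>\<^sup>+ \<omega>. ennreal ((inner (?U \<omega>) v + y \<omega>)\<^sup>2) \<partial>M)" for v
    by (simp add: affine_risk_def inner_prod_def add.commute)
  have "integrable M (\<lambda>\<omega>. (norm (?U \<omega>))\<^sup>2)"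
    using x2 by (simp add: norm_Pair)
  then have "\<exists>v0. \<forall>v. affine_risk M x y (fst v0) (snd v0) \<le> affine_risk M x y (fst v) (snd v)"
    unfolding risk by (intro least_squares_attains_min) measurable
  then show ?thesis by (metis fst_conv snd_conv)
qed

section \<open>Square integrability of Gaussian vectors\<close>

lemma integrable_centered_normal_square:
  assumes "0 \<le> s"
  shows "integrable (centered_normal s) (\<lambda>t. t\<^sup>2)"
proof (cases "s = 0")
  case True
  have "integrable (return borel 0) (\<lambda>t :: real. t\<^sup>2)"
    by (rule integrableI_bounded) (auto simp: nn_integral_return)
  then show ?thesis using True by (simp add: centered_normal_def)
next
  case False
  then show ?thesis
    using integrable_normal_moment[of s 0 2] assms
    by (simp add: centered_normal_def integrable_density)
qed

text \<open>The squared norm is the sum of the squared coordinates, and each coordinate is a linear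
  functional with a one-dimensional normal law. The argument covers singular \<Sigma>, where
  coordinates may be constant.\<close>

lemma centered_gaussian_integrable_norm_square:
  fixes x :: "'w \<Rightarrow> real^'d"
  assumes g: "centered_gaussian \<Sigma> (distr M borel x)" and [measurable]: "x \<in> borel_measurable M"
  shows "integrable M (\<lambda>\<omega>. (norm (x \<omega>))\<^sup>2)"
proof -
  have "integrable M (\<lambda>\<omega>. (inner t (x \<omega>))\<^sup>2)" for t
  proof -
    have "distr M borel (\<lambda>\<omega>. inner t (x \<omega>)) = centered_normal (sqrt (inner t (\<Sigma> *v t)))"
      using g by (simp add: centered_gaussian_def distr_distr o_def)
    moreover have "0 \<le> sqrt (inner t (\<Sigma> *v t))"
      using g by (simp add: centered_gaussian_def)
    ultimately have "integrable (distr M borel (\<lambda>\<omega>. inner t (x \<omega>))) (\<lambda>s. s\<^sup>2)"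
      by (simp add: integrable_centered_normal_square)
    then show ?thesis by (subst (asm) integrable_distr_eq) auto
  qed
  then have "integrable M (\<lambda>\<omega>. \<Sum>b\<in>Basis. (inner b (x \<omega>))\<^sup>2)" by auto
  also have "(\<lambda>\<omega>. \<Sum>b\<in>Basis. (inner b (x \<omega>))\<^sup>2) = (\<lambda>\<omega>. (norm (x \<omega>))\<^sup>2)"
    by (rule ext, subst norm_eq_sqrt_inner, subst euclidean_inner)
      (simp add: power2_eq_square inner_commute sum_nonneg)
  finally show ?thesis .
qed

section \<open>Conditioning on the context\<close>

text \<open>Independence makes the joint law a product, so by Tonelli one may integrate over
  \<open>U\<close> first with \<open>V\<close> frozen at \<open>v\<close>. Each inner integral is at
  least \<open>K\<close>, and the law of \<open>V\<close> has total mass \<open>1\<close>.\<close>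

lemma (in prob_space) indep_var_nn_integral_ge:
  assumes ind: "indep_var S V T U" and h: "h \<in> borel_measurable (S \<Otimes>\<^sub>M T)"
    and K: "\<And>v. v \<in> space S \<Longrightarrow> K \<le> (\<integral>\<^sup>+ \<omega>. h (v, U \<omega>) \<partial>M)"
  shows "K \<le> (\<integral>\<^sup>+ \<omega>. h (V \<omega>, U \<omega>) \<partial>M)"
proof -
  from ind have V: "V \<in> measurable M S" and U: "U \<in> measurable M T"
    and eq: "distr M S V \<Otimes>\<^sub>M distr M T U = distr M (S \<Otimes>\<^sub>M T) (\<lambda>\<omega>. (V \<omega>, U \<omega>))"
    unfolding indep_var_distribution_eq by auto
  interpret V: prob_space "distr M S V" by (rule prob_space_distr) fact
  interpret U: prob_space "distr M T U" by (rule prob_space_distr) fact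
  interpret pair_prob_space "distr M S V" "distr M T U" ..
  have "(\<integral>\<^sup>+ \<omega>. h (V \<omega>, U \<omega>) \<partial>M) = (\<integral>\<^sup>+ p. h p \<partial>(distr M S V \<Otimes>\<^sub>M distr M T U))"
    unfolding eq using V U h by (subst nn_integral_distr) auto
  also have "\<dots> = (\<integral>\<^sup>+ v. (\<integral>\<^sup>+ u. h (v, u) \<partial>distr M T U) \<partial>distr M S V)"
    using h by (subst U.nn_integral_fst[symmetric]) (auto cong: measurable_cong_sets)
  also have "\<dots> \<ge> (\<integral>\<^sup>+ v. K \<partial>distr M S V)"
  proof (rule nn_integral_mono)
    fix v assume "v \<in> space (distr M S V)"
    then have v: "v \<in> space S" by simp
    have "(\<lambda>u. h (v, u)) \<in> borel_measurable T"
      by (rule measurable_compose[OF measurable_Pair1'[OF v] h])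
    then have "(\<integral>\<^sup>+ u. h (v, u) \<partial>distr M T U) = (\<integral>\<^sup>+ \<omega>. h (v, U \<omega>) \<partial>M)"
      using U by (subst nn_integral_distr) auto
    then show "K \<le> (\<integral>\<^sup>+ u. h (v, u) \<partial>distr M T U)" using K[OF v] by simp
  qed
  finally show ?thesis using V.emeasure_space_1 by simp
qed

theorem proposition1:
  fixes M :: "'w measure"
    and X :: "nat \<Rightarrow> 'w \<Rightarrow> real^'d"
    and \<Sigma> :: "real^'d^'d"
    and f :: "real^'d \<Rightarrow> real"
    and c :: "nat \<Rightarrow> 'd"
    and n db :: nat
    and W :: "(real mat \<times> real mat) list"
  assumes "prob_space M"
    and "prob_space.indep_vars M (\<lambda>_. borel) X {..n}"
    and "\<And>i. i \<le> n \<Longrightarrow> centered_gaussian \<Sigma> (distr M borel (X i))"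
    and "f \<in> borel_measurable borel"
    and "bij_betw c {1..CARD('d)} UNIV"
    and "n \<ge> 1"
    and "db \<ge> CARD('d) + 1"
    and "\<And>P Q. (P, Q) \<in> set W \<Longrightarrow>
           P \<in> carrier_mat (db + 1) (db + 1) \<and> Q \<in> carrier_mat (db + 1) (db + 1)"
  shows "\<exists>\<alpha>\<^sub>0 \<beta>\<^sub>0.
    (\<forall>\<alpha> \<beta>. affine_risk M (X n) (\<lambda>\<omega>. f (X n \<omega>)) \<alpha>\<^sub>0 \<beta>\<^sub>0
          \<le> affine_risk M (X n) (\<lambda>\<omega>. f (X n \<omega>)) \<alpha> \<beta>) \<and>
    (\<integral>\<^sup>+ \<omega>. ennreal ((prediction db n W (prompt c db n f (\<lambda>i. X i \<omega>)) + f (X n \<omega>))\<^sup>2) \<partial>M)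
      \<ge> affine_risk M (X n) (\<lambda>\<omega>. f (X n \<omega>)) \<alpha>\<^sub>0 \<beta>\<^sub>0"
proof -
  interpret prob_space M by fact
  note ind = assms(2) and gauss = assms(3) and f[measurable] = assms(4) and db = assms(7)
  have W: "square_weights (Suc db) W"
    using assms(8) by (auto simp: square_weights_def)
  have X[measurable]: "X n \<in> borel_measurable M"
    using ind by (auto simp: indep_vars_def)
  have "integrable M (\<lambda>\<omega>. (norm (X n \<omega>))\<^sup>2)"
    by (rule centered_gaussian_integrable_norm_square[OF gauss X]) simp
  \<comment> \<open>Square integrability of the query alone yields a minimizer; the minimal risk
    itself may be infinite.\<close>
  then obtain \<alpha>0 \<beta>0 where
    min: "\<And>\<alpha> \<beta>. affine_risk M (X n) (\<lambda>\<omega>. f (X n \<omega>)) \<alpha>0 \<beta>0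
       \<le> affine_risk M (X n) (\<lambda>\<omega>. f (X n \<omega>)) \<alpha> \<beta>"
    using affine_risk_attains_min[OF \<open>prob_space M\<close> X, of "\<lambda>\<omega>. f (X n \<omega>)"] by auto

  define S where "S = PiM {..<n} (\<lambda>_. borel :: (real^'d) measure)"
  define D where "D \<omega> = restrict (\<lambda>i. X i \<omega>) {..<n}" for \<omega>
  \<comment> \<open>The query slot gets the dummy value \<open>0\<close>, making the multiplier a
    function of the context \<open>w\<close> only.\<close>
  define T where "T w = transformer_multiplier n W (prompt c db n f (w(n := 0)))" for w
  define a where "a w = T w $$ (db, 0)" for w
  define b where "b w = (\<Sum>k=1..CARD('d). T w $$ (db, k) *\<^sub>R axis (c k) (1::real))" for w

  have "measurable_mat S (Suc db) (Suc n) (\<lambda>w. prompt c db n f (w(n := 0)))"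
  proof (rule measurable_mat_prompt[OF f])
    show "(\<lambda>w. (w(n := 0)) j) \<in> borel_measurable S" if "j \<le> n" for j
      using that by (cases "j = n") (auto simp: S_def)
  qed
  then have T: "measurable_mat S (Suc db) (Suc db) T"
    unfolding T_def using W by (rule measurable_mat_transformer_multiplier)
  have a[measurable]: "a \<in> borel_measurable S"
    using T by (simp add: a_def[abs_def] measurable_mat_def)
  have b[measurable]: "b \<in> borel_measurable S"
    unfolding b_def[abs_def] using T db
    by (intro borel_measurable_sum borel_measurable_scaleR) (auto simp: measurable_mat_def)

  \<comment> \<open>The prompts with the true query and with the dummy agree in the first
    \<open>n\<close> columns.\<close>
  have ctx: "transformer_multiplier n W (prompt c db n f (\<lambda>i. X i \<omega>)) = T (D \<omega>)" for \<omega>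
    unfolding T_def
    by (rule transformer_multiplier_cong[OF mult_mask_cong _ _ W])
      (auto simp: prompt_def D_def)
  have pred: "prediction db n W (prompt c db n f (\<lambda>i. X i \<omega>)) =
      inner (X n \<omega>) (b (D \<omega>)) + a (D \<omega>)" for \<omega>
    using prediction_affine[OF W db, of n c f "\<lambda>i. X i \<omega>"]
    unfolding ctx a_def b_def .

  \<comment> \<open>The query is packaged as a family over \<open>{n}\<close>, so that its
    independence from \<open>D\<close> comes from splitting \<open>{..n}\<close> into disjoint index
    sets.\<close>
  define U where "U \<omega> = restrict (\<lambda>i. X i \<omega>) {n}" for \<omega>
  have indep: "indep_var S D (PiM {n} (\<lambda>_. borel)) U"
    unfolding S_def D_def U_def by (rule indep_var_restrict[OF ind]) auto
  define h where "h p = ennreal ((inner (snd p n) (b (fst p)) + a (fst p) + f (snd p n))\<^sup>2)" for p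
  have hU: "h (v, U \<omega>) = ennreal ((inner (X n \<omega>) (b v) + a v + f (X n \<omega>))\<^sup>2)" for v \<omega>
    by (simp add: h_def U_def)
  have "h \<in> borel_measurable (S \<Otimes>\<^sub>M PiM {n} (\<lambda>_. borel))"
    unfolding h_def[abs_def] by measurable
  \<comment> \<open>For a frozen context \<open>v\<close>, the integral over the query is the affine
    risk at intercept \<open>a v\<close> and slope \<open>b v\<close>, hence at least the
    minimum.\<close>
  from indep_var_nn_integral_ge[OF indep this]
  have "affine_risk M (X n) (\<lambda>\<omega>. f (X n \<omega>)) \<alpha>0 \<beta>0 \<le> (\<integral>\<^sup>+ \<omega>. h (D \<omega>, U \<omega>) \<partial>M)"
    using min by (simp add: hU affine_risk_def)
  then show ?thesis
    using min unfolding pred hU by (intro exI[of _ \<alpha>0] exI[of _ \<beta>0]) simp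
qed

end
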